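(* Let $R$ be a graph on $s$ vertices having exactly $\ell$ vertices of degree one. Then \[ \operatorname{fl}(R)\le 5\cdot 2^{s-2}+(s-\ell-2)\,2^{s-\ell-1}. \]
   Context: For a finite simple graph $R$, let $\mathrm{Ind}(R)$ be the set of independent sets of $R$, and for a nonempty $I\subseteq V(R)$ let $\delta_I=\min\{d_R(x):x\in I\}$, where $d_R$ is the degree in $R$. The fixed loss of $R$ is $\operatorname{fl}(R)=\sum_{I\in\mathrm{Ind}(R),\,I\neq\emptyset}(2^{\delta_I}-1)$. *)

theory Defs
  imports Complex_Main "Graph_Theory.Pair_Digraph"
begin

text \<open>
  A finite simple graph is a \<^locale>\<open>pair_graph\<close>: a finite, loop-free, symmetric digraph whose arcs are
  pairs of vertices. The undirected edge between \<open>x\<close> and \<open>y\<close> is represented by the two arcs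
  \<open>(x, y)\<close> and \<open>(y, x)\<close>, so the undirected degree of a vertex is its out-degree.
\<close>

definition degree :: "'a pair_pre_digraph \<Rightarrow> 'a \<Rightarrow> nat" where
  "degree R x = out_degree (with_proj R) x"

definition Ind :: "'a pair_pre_digraph \<Rightarrow> 'a set set" where
  "Ind R = {I. I \<subseteq> pverts R \<and> (\<forall>x\<in>I. \<forall>y\<in>I. (x, y) \<notin> parcs R)}"

definition min_degree_on :: "'a pair_pre_digraph \<Rightarrow> 'a set \<Rightarrow> nat" where
  "min_degree_on R I = Min (degree R ` I)"

definition fixed_loss :: "'a pair_pre_digraph \<Rightarrow> int" where
  "fixed_loss R = (\<Sum>I\<in>Ind R - {{}}. 2 ^ min_degree_on R I - 1)"

end

theory Submission
  imports Defs
begin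

text \<open>
  Let \<open>L\<close> be the set of the \<open>l\<close> vertices of degree one and \<open>M\<close> the set of the \<open>m = s - l\<close> others.
  An independent set that meets \<open>L\<close> contributes at most 1. If \<open>u \<in> L\<close> has the neighbour \<open>v\<close>, such a
  set neither lies in \<open>M\<close> nor contains both \<open>u\<close> and \<open>v\<close>, which leaves at most
  \<open>2 ^ s - 2 ^ m - 2 ^ (s - 2)\<close> sets.

  For an independent set \<open>I \<subseteq> M\<close>, bound the contribution by the sum of \<open>2 ^ d x\<close> over \<open>x \<in> I\<close>. If \<open>x\<close>
  has \<open>d' x\<close> neighbours in \<open>M\<close> and \<open>f x\<close> neighbours in \<open>L\<close>, it lies in at most \<open>2 ^ (m - 1 - d' x)\<close>
  independent subsets of \<open>M\<close>, so it contributes at most \<open>2 ^ (m - 1 + f x)\<close> in total. The sum of all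
  \<open>f x\<close> is at most \<open>l\<close>, and by convexity the worst case is that all leaves hang on one vertex.
\<close>

text \<open>The function \<open>2 ^ n - 1\<close> is superadditive because
  \<open>(2 ^ a - 1) * (2 ^ b - 1)\<close> is nonnegative. This is the convexity step that moves all
  leaves to one vertex.\<close>

lemma sum_power2_minus_one_le:
  fixes f :: "'b \<Rightarrow> nat"
  assumes "finite A"
  shows "(\<Sum>x\<in>A. 2 ^ f x - 1 :: int) \<le> 2 ^ (\<Sum>x\<in>A. f x) - 1"
  using assms
proof (induction A)
  case (insert x A)
  have "0 \<le> (2 ^ f x - 1 :: int) * (2 ^ sum f A - 1)"
    by (intro mult_nonneg_nonneg) auto
  then show ?case
    using insert by (simp add: power_add algebra_simps)
qed simp

context
  fixes R :: "'a pair_pre_digraph"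
  assumes R: "pair_graph R"
begin

interpretation pair_graph R
  by (rule R)

private abbreviation (input) nbrs :: "'a \<Rightarrow> 'a set" where
  "nbrs x \<equiv> {y. (x, y) \<in> parcs R}"

private abbreviation (input) leaves :: "'a set" where
  "leaves \<equiv> {x \<in> pverts R. degree R x = 1}"

private abbreviation (input) nonleaves :: "'a set" where
  "nonleaves \<equiv> pverts R - leaves"

lemma degree_eq_card_nbrs: "degree R x = card (nbrs x)"
proof -
  have "out_arcs (with_proj R) x = Pair x ` nbrs x"
    by (auto simp: out_arcs_def)
  then show ?thesis
    by (simp add: degree_def out_degree_def card_image inj_on_def)
qed

lemma nbrs_subset: "nbrs x \<subseteq> pverts R"
  using in_arcsD2 by auto

lemma finite_nbrs: "finite (nbrs x)"
  by (rule finite_subset[OF nbrs_subset]) simp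

lemma nbrs_sym: "(x, y) \<in> parcs R \<longleftrightarrow> (y, x) \<in> parcs R"
  using arcs_symmetric by blast

lemma nbrs_irrefl: "(x, x) \<notin> parcs R"
  using no_loops by fastforce

lemma finite_Ind: "finite (Ind R)"
  by (rule finite_subset[of _ "Pow (pverts R)"]) (auto simp: Ind_def)

lemma finite_member_Ind: "I \<in> Ind R \<Longrightarrow> finite I"
  by (rule finite_subset[of _ "pverts R"]) (auto simp: Ind_def)

lemma min_degree_on_le:
  assumes "I \<in> Ind R" "x \<in> I"
  shows "min_degree_on R I \<le> degree R x"
  using assms finite_member_Ind by (simp add: min_degree_on_def)

text \<open>A leaf has a single neighbour, so different vertices have disjoint sets of leaf
  neighbours. Equality can fail, since two leaves may be adjacent to each other.\<close>

lemma sum_leaf_nbrs_le: "(\<Sum>x\<in>nonleaves. card (nbrs x \<inter> leaves)) \<le> card leaves"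
proof -
  have "x = x'" if "y \<in> leaves" "y \<in> nbrs x" "y \<in> nbrs x'" for x x' y
  proof -
    obtain z where "nbrs y = {z}"
      using \<open>y \<in> leaves\<close> by (auto simp: degree_eq_card_nbrs card_1_singleton_iff)
    moreover have "x \<in> nbrs y" "x' \<in> nbrs y"
      using that nbrs_sym by auto
    ultimately show ?thesis
      by simp
  qed
  then have "(\<Sum>x\<in>nonleaves. card (nbrs x \<inter> leaves)) = card (\<Union>x\<in>nonleaves. nbrs x \<inter> leaves)"
    by (intro card_UN_disjoint[symmetric]) (use finite_nbrs in auto)
  also have "\<dots> \<le> card leaves"
    by (intro card_mono) auto
  finally show ?thesis .
qed

text \<open>Apart from \<open>x\<close>, such a set lies in \<open>?B\<close>, the non-leaves that
  are neither \<open>x\<close> nor adjacent to it. The non-leaf part of the degree lost in the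
  exponent of the count comes back in \<open>2 ^ degree R x\<close>, so only the leaf neighbours
  remain.\<close>

lemma card_Ind_nonleaves_containing_le:
  assumes "x \<in> nonleaves"
  shows "card {I \<in> Ind R. I \<subseteq> nonleaves \<and> x \<in> I} * 2 ^ degree R x
    \<le> 2 ^ (card nonleaves - 1 + card (nbrs x \<inter> leaves))"
proof -
  let ?B = "nonleaves - {x} - (nbrs x \<inter> nonleaves)"
  have fin: "finite nonleaves"
    by auto
  have sub: "nbrs x \<inter> nonleaves \<subseteq> nonleaves - {x}"
    using nbrs_irrefl by auto
  have cardB: "card ?B = card nonleaves - 1 - card (nbrs x \<inter> nonleaves)"
    using assms fin sub by (subst card_Diff_subset) auto
  have le: "card (nbrs x \<inter> nonleaves) \<le> card nonleaves - 1"
    using card_mono[OF _ sub] assms fin by auto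
  have "nbrs x = (nbrs x \<inter> nonleaves) \<union> (nbrs x \<inter> leaves)"
    using nbrs_subset by auto
  then have deg: "degree R x = card (nbrs x \<inter> nonleaves) + card (nbrs x \<inter> leaves)"
    unfolding degree_eq_card_nbrs
    by (subst card_Un_disjoint[symmetric]) (use finite_nbrs in auto)
  have "I \<in> insert x ` Pow ?B" if "I \<in> Ind R" "I \<subseteq> nonleaves" "x \<in> I" for I
    by (rule image_eqI[of _ _ "I - {x}"]) (use that in \<open>auto simp: Ind_def\<close>)
  then have "{I \<in> Ind R. I \<subseteq> nonleaves \<and> x \<in> I} \<subseteq> insert x ` Pow ?B"
    by blast
  then have "card {I \<in> Ind R. I \<subseteq> nonleaves \<and> x \<in> I} \<le> card (Pow ?B)"
    by (rule surj_card_le[rotated]) (use fin in auto)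
  then have "card {I \<in> Ind R. I \<subseteq> nonleaves \<and> x \<in> I} \<le> 2 ^ card ?B"
    using fin by (simp add: card_Pow)
  then have "card {I \<in> Ind R. I \<subseteq> nonleaves \<and> x \<in> I} * 2 ^ degree R x
      \<le> 2 ^ card ?B * 2 ^ degree R x"
    by (rule mult_right_mono) simp
  also have "\<dots> = 2 ^ (card nonleaves - 1 + card (nbrs x \<inter> leaves))"
    \<comment> \<open>The fact \<open>le\<close> makes the truncated subtraction exact, so the two
      occurrences of the non-leaf degree cancel.\<close>
    unfolding cardB deg using le by (simp flip: power_add)
  finally show ?thesis .
qed

lemma sum_Ind_nonleaves_le:
  "(\<Sum>I | I \<in> Ind R - {{}} \<and> I \<subseteq> nonleaves. 2 ^ min_degree_on R I - 1 :: int)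
    \<le> 2 ^ (card nonleaves - 1) * (2 ^ card leaves + int (card nonleaves) - 1)"
proof -
  let ?S = "{I. I \<in> Ind R - {{}} \<and> I \<subseteq> nonleaves}"
  let ?m = "card nonleaves"
  let ?f = "\<lambda>x. card (nbrs x \<inter> leaves)"
  have finS: "finite ?S"
    using finite_Ind by (auto intro: finite_subset[of _ "Ind R"])
  \<comment> \<open>One member of \<open>I\<close> would suffice as a bound; summing over all of
    them avoids a choice and lets the two sums be exchanged.\<close>
  have "(\<Sum>I\<in>?S. 2 ^ min_degree_on R I - 1 :: int)
      \<le> (\<Sum>I\<in>?S. \<Sum>x | x \<in> nonleaves \<and> x \<in> I. 2 ^ degree R x)"
  proof (rule sum_mono)
    fix I assume I: "I \<in> ?S"
    then obtain x where x: "x \<in> I"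
      by auto
    have "2 ^ min_degree_on R I - 1 \<le> (2 ^ degree R x :: int)"
    proof -
      have "min_degree_on R I \<le> degree R x"
        using I x by (intro min_degree_on_le) auto
      then have "(2::int) ^ min_degree_on R I \<le> 2 ^ degree R x"
        by (rule power_increasing) simp
      then show ?thesis
        by linarith
    qed
    also have "\<dots> \<le> (\<Sum>x | x \<in> nonleaves \<and> x \<in> I. 2 ^ degree R x)"
      by (rule member_le_sum) (use I x in auto)
    finally show "2 ^ min_degree_on R I - 1 \<le> (\<Sum>x | x \<in> nonleaves \<and> x \<in> I. 2 ^ degree R x :: int)" .
  qed
  also have "\<dots> = (\<Sum>x\<in>nonleaves. \<Sum>I | I \<in> ?S \<and> x \<in> I. 2 ^ degree R x)"
    by (rule sum.swap_restrict) (use finS in auto)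
  also have "\<dots> \<le> (\<Sum>x\<in>nonleaves. 2 ^ (?m - 1 + ?f x))"
  proof (rule sum_mono)
    fix x assume x: "x \<in> nonleaves"
    have "{I. I \<in> ?S \<and> x \<in> I} = {I \<in> Ind R. I \<subseteq> nonleaves \<and> x \<in> I}"
      by blast
    then have "(\<Sum>I | I \<in> ?S \<and> x \<in> I. 2 ^ degree R x :: int)
        = int (card {I \<in> Ind R. I \<subseteq> nonleaves \<and> x \<in> I} * 2 ^ degree R x)"
      by simp
    also have "\<dots> \<le> int (2 ^ (?m - 1 + ?f x))"
      using card_Ind_nonleaves_containing_le[OF x] by (simp only: of_nat_le_iff)
    finally show "(\<Sum>I | I \<in> ?S \<and> x \<in> I. 2 ^ degree R x :: int) \<le> 2 ^ (?m - 1 + ?f x)"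
      by simp
  qed
  \<comment> \<open>A 1 is split off each term to reach the superadditive form; these add up to
    \<open>int ?m\<close>.\<close>
  also have "\<dots> = 2 ^ (?m - 1) * ((\<Sum>x\<in>nonleaves. 2 ^ ?f x - 1) + int ?m)"
    by (simp add: power_add sum_distrib_left sum_subtractf)
  also have "\<dots> \<le> 2 ^ (?m - 1) * ((2 ^ card leaves - 1) + int ?m)"
  proof -
    have "(\<Sum>x\<in>nonleaves. 2 ^ ?f x - 1 :: int) \<le> 2 ^ (\<Sum>x\<in>nonleaves. ?f x) - 1"
      by (rule sum_power2_minus_one_le) auto
    also have "\<dots> \<le> 2 ^ card leaves - 1"
      using power_increasing[OF sum_leaf_nbrs_le, of "2::int"] by linarith
    finally show ?thesis
      by simp
  qed
  finally show ?thesis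
    by (simp add: algebra_simps)
qed

lemma card_Ind_meeting_leaves_le:
  assumes "leaves \<noteq> {}"
  shows "card {I \<in> Ind R. \<not> I \<subseteq> nonleaves} + 2 ^ card nonleaves + 2 ^ (card (pverts R) - 2)
    \<le> 2 ^ card (pverts R)"
proof -
  obtain u where u: "u \<in> leaves"
    using assms by blast
  then obtain v where "nbrs u = {v}"
    by (auto simp: degree_eq_card_nbrs card_1_singleton_iff)
  then have uv: "(u, v) \<in> parcs R"
    by auto
  then have v: "v \<in> pverts R" "u \<noteq> v"
    using nbrs_subset nbrs_irrefl by auto
  let ?A = "{I \<in> Ind R. \<not> I \<subseteq> nonleaves}"
  let ?C = "(\<lambda>S. insert u (insert v S)) ` Pow (pverts R - {u, v})"
  have "inj_on (\<lambda>S. insert u (insert v S)) (Pow (pverts R - {u, v}))"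
    by (rule inj_on_inverseI[of _ "\<lambda>S. S - {u, v}"]) auto
  then have cardC: "card ?C = 2 ^ (card (pverts R) - 2)"
    using u v by (simp add: card_image card_Pow card_Diff_subset)
  have "finite ?A"
    using finite_Ind by simp
  \<comment> \<open>Members of \<open>?C\<close> contain the leaf \<open>u\<close>, so they are not
    in \<open>Pow nonleaves\<close>, and the edge from \<open>u\<close> to \<open>v\<close>, so they
    are not independent. The three families are thus packed disjointly into the power set.\<close>
  moreover have "?A \<inter> Pow nonleaves = {}" "(?A \<union> Pow nonleaves) \<inter> ?C = {}"
    using uv u by (auto simp: Ind_def)
  ultimately have "card (?A \<union> Pow nonleaves \<union> ?C) = card ?A + 2 ^ card nonleaves + 2 ^ (card (pverts R) - 2)"
    by (simp add: card_Un_disjoint cardC card_Pow)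
  moreover have "card (?A \<union> Pow nonleaves \<union> ?C) \<le> card (Pow (pverts R))"
    by (rule card_mono) (use u v in \<open>auto simp: Ind_def\<close>)
  ultimately show ?thesis
    by (simp add: card_Pow)
qed

lemma sum_Ind_meeting_leaves_le:
  "(\<Sum>I | I \<in> Ind R - {{}} \<and> \<not> I \<subseteq> nonleaves. 2 ^ min_degree_on R I - 1 :: int)
    \<le> int (card {I \<in> Ind R. \<not> I \<subseteq> nonleaves})"
proof -
  have eq: "{I. I \<in> Ind R - {{}} \<and> \<not> I \<subseteq> nonleaves} = {I \<in> Ind R. \<not> I \<subseteq> nonleaves}"
    by auto
  have "(\<Sum>I | I \<in> Ind R \<and> \<not> I \<subseteq> nonleaves. 2 ^ min_degree_on R I - 1 :: int)
      \<le> (\<Sum>I | I \<in> Ind R \<and> \<not> I \<subseteq> nonleaves. 1)"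
  proof (rule sum_mono)
    fix I assume I: "I \<in> {I \<in> Ind R. \<not> I \<subseteq> nonleaves}"
    then obtain x where "x \<in> I" "x \<in> leaves"
      by (auto simp: Ind_def)
    then have "min_degree_on R I \<le> 1"
      using min_degree_on_le[of I x] I by auto
    then have "(2::int) ^ min_degree_on R I \<le> 2 ^ 1"
      by (rule power_increasing) simp
    then show "2 ^ min_degree_on R I - 1 \<le> (1::int)"
      by simp
  qed
  then show ?thesis
    unfolding eq by simp
qed

lemma fixed_loss_split:
  "fixed_loss R = (\<Sum>I | I \<in> Ind R - {{}} \<and> I \<subseteq> nonleaves. 2 ^ min_degree_on R I - 1)
    + (\<Sum>I | I \<in> Ind R - {{}} \<and> \<not> I \<subseteq> nonleaves. 2 ^ min_degree_on R I - 1)"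
proof -
  have "{I. I \<in> Ind R - {{}} \<and> I \<subseteq> nonleaves} = (Ind R - {{}}) \<inter> Pow nonleaves"
    "{I. I \<in> Ind R - {{}} \<and> \<not> I \<subseteq> nonleaves} = (Ind R - {{}}) - Pow nonleaves"
    by blast+
  then show ?thesis
    by (simp only: fixed_loss_def) (rule sum.Int_Diff, simp add: finite_Ind)
qed

end

theorem theorem4p4:
  fixes R :: "'a pair_pre_digraph" and s l :: nat
  assumes "pair_graph R"
    and "card (pverts R) = s"
    and "card {x \<in> pverts R. degree R x = 1} = l"
  shows "real_of_int (fixed_loss R)
    \<le> 5 * 2 powi (int s - 2) + (real s - real l - 2) * 2 powi (int s - int l - 1)"
proof -
  interpret pair_graph R
    by fact
  let ?L = "{x \<in> pverts R. degree R x = 1}"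
  let ?M = "pverts R - ?L"
  define N where "N = (\<Sum>I | I \<in> Ind R - {{}} \<and> I \<subseteq> ?M. 2 ^ min_degree_on R I - 1 :: int)"
  define c where "c = card {I \<in> Ind R. \<not> I \<subseteq> ?M}"
  define m where "m = card ?M"
  have s: "s = m + l"
    using assms(2,3) card_Diff_subset[of ?L "pverts R"] card_mono[of "pverts R" ?L]
    by (auto simp: m_def)
  have fl: "real_of_int (fixed_loss R) \<le> real_of_int N + real c"
    using sum_Ind_meeting_leaves_le[OF assms(1)] fixed_loss_split[OF assms(1)]
    unfolding N_def c_def by linarith
  \<comment> \<open>Here \<open>3 * 2 powi (int s - 2)\<close> is
    \<open>2 ^ s - 2 ^ (s - 2)\<close>. The packing argument needs a leaf, hence the separate
    case.\<close>
  have c_le: "real c \<le> (if l = 0 then 0 else 3 * 2 powi (int s - 2) - 2 ^ m)"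
  proof (cases "l = 0")
    case True
    then have "?L = {}"
      using assms(3) by (simp only: card_eq_0_iff) auto
    then have "{I \<in> Ind R. \<not> I \<subseteq> ?M} = {}"
      by (auto simp: Ind_def)
    then show ?thesis
      unfolding c_def using True by (simp only: card.empty) simp
  next
    case False
    then have "?L \<noteq> {}"
      using assms(3) by (metis card.empty)
    then obtain u where u: "u \<in> ?L"
      by blast
    then obtain v where uv: "(u, v) \<in> parcs R"
      by (auto simp: degree_eq_card_nbrs[OF assms(1)] card_1_singleton_iff)
    then have "u \<noteq> v" "{u, v} \<subseteq> pverts R"
      using nbrs_irrefl[OF assms(1)] in_arcsD1 in_arcsD2 by auto
    \<comment> \<open>From here on the natural number \<open>s - 2\<close> agrees with the integer
      exponent.\<close>
    then have "s \<ge> 2"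
      using card_mono[of "pverts R" "{u, v}"] assms(2) by auto
    then obtain k where k: "s = k + 2"
      using le_Suc_ex by (metis add.commute)
    have "c + 2 ^ m + 2 ^ (s - 2) \<le> 2 ^ s"
      using card_Ind_meeting_leaves_le[OF assms(1)] u assms(2) unfolding c_def m_def by blast
    then have "real (c + 2 ^ m + 2 ^ k) \<le> real (2 ^ (k + 2))"
      unfolding k of_nat_le_iff by simp
    then show ?thesis
      using False by (simp add: k)
  qed
  show ?thesis
  proof (cases m)
    \<comment> \<open>Every vertex is a leaf, so \<open>s = l\<close> and the last term of the bound
      is \<open>-2 * 2 powi (-1)\<close>, that is, -1. For \<open>s = 0\<close> the claim reads
      \<open>0 \<le> 5 / 4 - 1\<close>.\<close>
    case 0
    then have "?M = {}"
      by (simp add: m_def)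
    then have "N = 0"
      unfolding N_def by (intro sum.neutral) blast
    moreover have "2 powi (int l - 2) > (0::real)"
      by simp
    ultimately show ?thesis
      using fl c_le s 0 by (cases "l = 0") (auto simp: power_int_def power2_eq_square)
  next
    case (Suc n)
    have "N \<le> 2 ^ n * (2 ^ l + int n)"
      using sum_Ind_nonleaves_le[OF assms(1)] Suc unfolding assms(3) m_def[symmetric] N_def[symmetric] by simp
    then have "real_of_int N \<le> real_of_int (2 ^ n * (2 ^ l + int n))"
      by (simp only: of_int_le_iff)
    then have N_le: "real_of_int N \<le> 2 ^ (n + l) + real n * 2 ^ n"
      by (simp add: algebra_simps power_add)
    have "(2::real) ^ (n + l) = 2 powi ((int s - 2) + 1)"
      using s Suc by (simp add: power_int_def nat_add_distrib)
    also have "\<dots> = 2 * 2 powi (int s - 2)"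
      by (subst power_int_add) auto
    finally have P: "(2::real) ^ (n + l) = 2 * 2 powi (int s - 2)" .
    have rhs: "(real s - real l - 2) * 2 powi (int s - int l - 1) = real n * 2 ^ n - (2::real) ^ n"
      using s Suc by (simp add: algebra_simps)
    show ?thesis
    proof (cases "l = 0")
      \<comment> \<open>Put \<open>q = 2 powi (int s - 2)\<close>. Without leaves
        \<open>2 ^ n = 2 * q\<close>, so the right-hand side is
        \<open>3 * q + real n * 2 ^ n\<close>, while the loss is at most
        \<open>2 * q + real n * 2 ^ n\<close>.\<close>
      case True
      then have "(2::real) ^ n = 2 * 2 powi (int s - 2)" "c = 0" "(2::real) ^ n > 0"
        using P c_le by auto
      then show ?thesis
        unfolding rhs using fl N_le P by linarith
    next
      \<comment> \<open>The bounds on \<open>N\<close> and \<open>c\<close> add up to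
        \<open>5 * 2 powi (int s - 2) + real n * 2 ^ n - 2 * 2 ^ n\<close>, which leaves a slack of
        \<open>2 ^ n\<close>.\<close>
      case False
      moreover have "(2::real) ^ m = 2 * 2 ^ n" "(2::real) ^ n > 0"
        using Suc by auto
      ultimately show ?thesis
        unfolding rhs using fl N_le P c_le by (simp only: if_False)
    qed
  qed
qed

end
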